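(* (Infinitesimal Bianchi identity.) Let $\mathfrak k$ be a bundle of ideals of a Lie algebroid $A\Rightarrow M$. The horizontal exterior covariant derivative of the curvature of any IM connection $(\mathcal C,v)\in\mathcal A(A;\mathfrak k)$ vanishes: $$D^{(\mathcal C,v)}\Omega^{(\mathcal C,v)}=0.$$
   Context: $\rho$ is the anchor of $A$. A bundle of ideals is a vector subbundle $\mathfrak k\subset\ker\rho\subset A$ with $[\Gamma(A),\Gamma(\mathfrak k)]\subset\Gamma(\mathfrak k)$. $W^{1,q}(A;\mathfrak k)$ consists of pairs $c=(c_0,c_1)$, $c_0\colon\Gamma(A)\to\Omega^q(M;\mathfrak k)$ $\mathbb R$-linear, $c_1\colon\Gamma(A)\to\Omega^{q-1}(M;\mathfrak k)$ $C^\infty(M)$-linear, with $c_0(f\alpha)=fc_0(\alpha)+\mathrm df\wedge c_1(\alpha)$. With $(\mathcal L^A_\alpha\gamma)(\underline X)=[\alpha,\gamma(\underline X)]-\sum_j\gamma(\dots,[\rho(\alpha),X_j],\dots)$ on $\Omega^\bullet(M;\mathfrak k)$, $c$ is an IM form if $c_0[\alpha,\beta]=\mathcal L^A_\alpha c_0(\beta)-\mathcal L^A_\beta c_0(\alpha)$, $c_1[\alpha,\beta]=\mathcal L^A_\alpha c_1(\beta)-\iota_{\rho(\beta)}c_0(\alpha)$, $\iota_{\rho(\alpha)}c_1(\beta)=-\iota_{\rho(\beta)}c_1(\alpha)$; their space is $\Omega^q_{im}(A;\mathfrak k)$. An IM connection is $(\mathcal C,v)\in\Omega^1_{im}(A;\mathfrak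 k)$ with $v|_{\mathfrak k}=\mathrm{id}_{\mathfrak k}$; the set of these is $\mathcal A(A;\mathfrak k)$. Put $h=\mathrm{id}_A-v$, and let $\nabla_X\xi=\mathcal C(\xi)(X)$ be the induced linear connection on $\mathfrak k$. For $c\in W^{1,q}(A;\mathfrak k)$ the horizontal exterior covariant derivative $D^{(\mathcal C,v)}c\in W^{1,q+1}(A;\mathfrak k)$ is $$(D^{(\mathcal C,v)}c)_0(\alpha)=\mathrm d^\nabla c_0(\alpha)-\kappa\dot\wedge\mathcal C\alpha,\quad (D^{(\mathcal C,v)}c)_1(\beta)=\kappa(h\beta),\quad\kappa(\beta)=c_0(\beta)-\mathrm d^\nabla(c_1(\beta)),$$ where $\kappa$ is $C^\infty(M)$-linear and $(\kappa\dot\wedge\mathcal C\alpha)(X_0,\dots,X_q)=\sum_i(-1)^i\kappa(\mathcal C\alpha(X_i))(X_0,\dots,\widehat{X_i},\dots,X_q)$. The curvature of $(\mathcal C,v)$ is $\Omega^{(\mathcal C,v)}=D^{(\mathcal C,v)}(\mathcal C,v)\in\Omega^2_{im}(A;\mathfrak k)$. *)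

theory Defs
  imports "HOL-Analysis.Analysis" "HOL-Library.Function_Algebras"
begin

text \<open>
  The point set of the base manifold is the type \<open>'m\<close>. Euclidean space of dimension \<open>n\<close> is
  \<^const>\<open>Euclidean_space\<close> \<open>n\<close>, the sequences vanishing from index \<open>n\<close> on; dimension and ranks are
  natural numbers, so that dimension 0 (Lie algebras) and rank 0 are included. Sums, differences
  and zeros of functions, vector fields, sections and forms are the pointwise ones.
\<close>

section \<open>Smooth functions\<close>

definition partial_deriv :: "nat \<Rightarrow> ((nat \<Rightarrow> real) \<Rightarrow> real) \<Rightarrow> (nat \<Rightarrow> real) \<Rightarrow> real" where
  "partial_deriv i f x = deriv (\<lambda>t. f (x(i := t))) (x i)"

text \<open>\<open>Ck_on n S k f\<close>: on the open set \<open>S\<close> of \<open>n\<close>-dimensional Euclidean space, all partial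
  derivatives of \<open>f\<close> of order at most \<open>k\<close> exist and are continuous.\<close>

primrec Ck_on :: "nat \<Rightarrow> (nat \<Rightarrow> real) set \<Rightarrow> nat \<Rightarrow> ((nat \<Rightarrow> real) \<Rightarrow> real) \<Rightarrow> bool" where
  "Ck_on n S 0 f \<longleftrightarrow> continuous_on S f"
| "Ck_on n S (Suc k) f \<longleftrightarrow> continuous_on S f \<and>
     (\<forall>i<n. (\<forall>x\<in>S. (\<lambda>t. f (x(i := t))) differentiable (at (x i))) \<and>
            Ck_on n S k (partial_deriv i f))"

definition Cinf_on :: "nat \<Rightarrow> (nat \<Rightarrow> real) set \<Rightarrow> ((nat \<Rightarrow> real) \<Rightarrow> real) \<Rightarrow> bool" where
  "Cinf_on n S f \<longleftrightarrow> (\<forall>k. Ck_on n S k f)"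

record 'm manifold =
  mdim :: nat
  charts :: "('m set \<times> ('m \<Rightarrow> nat \<Rightarrow> real)) set"

definition smooth_manifold ::
    "('m::{t2_space,second_countable_topology}, 'z) manifold_scheme \<Rightarrow> bool" where
  "smooth_manifold M \<longleftrightarrow>
     (\<Union>(U, \<phi>)\<in>charts M. U) = UNIV \<and>
     (\<forall>(U, \<phi>)\<in>charts M. open U \<and> openin (Euclidean_space (mdim M)) (\<phi> ` U) \<and>
        homeomorphism U (\<phi> ` U) \<phi> (inv_into U \<phi>)) \<and>
     (\<forall>(U, \<phi>)\<in>charts M. \<forall>(V, \<psi>)\<in>charts M. \<forall>i<mdim M.
        Cinf_on (mdim M) (\<phi> ` (U \<inter> V)) (\<lambda>y. \<psi> (inv_into U \<phi> y) i))"

definition smooth_on :: "('m, 'z) manifold_scheme \<Rightarrow> 'm set \<Rightarrow> ('m \<Rightarrow> real) \<Rightarrow> bool" where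
  "smooth_on M W f \<longleftrightarrow>
     (\<forall>(U, \<phi>)\<in>charts M. Cinf_on (mdim M) (\<phi> ` (U \<inter> W)) (\<lambda>y. f (inv_into U \<phi> y)))"

definition Cinf :: "('m, 'z) manifold_scheme \<Rightarrow> ('m \<Rightarrow> real) set" where
  "Cinf M = {f. smooth_on M UNIV f}"

section \<open>Vector fields\<close>

text \<open>Tangent vectors at \<open>x\<close> are the derivations of the smooth functions at \<open>x\<close>. As functions in HOL
  are total, they are extended by 0 to non-smooth functions, which makes the representation unique.\<close>

definition tangent_space :: "('m, 'z) manifold_scheme \<Rightarrow> 'm \<Rightarrow> (('m \<Rightarrow> real) \<Rightarrow> real) set" where
  "tangent_space M x = {w.
     (\<forall>f\<in>Cinf M. \<forall>g\<in>Cinf M. \<forall>a b. w (\<lambda>y. a * f y + b * g y) = a * w f + b * w g) \<and>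
     (\<forall>f\<in>Cinf M. \<forall>g\<in>Cinf M. w (\<lambda>y. f y * g y) = f x * w g + g x * w f) \<and>
     (\<forall>f. f \<notin> Cinf M \<longrightarrow> w f = 0)}"

type_synonym 'm vfield = "'m \<Rightarrow> ('m \<Rightarrow> real) \<Rightarrow> real"

definition vfields :: "('m, 'z) manifold_scheme \<Rightarrow> 'm vfield set" where
  "vfields M = {X. (\<forall>x. X x \<in> tangent_space M x) \<and> (\<forall>f\<in>Cinf M. (\<lambda>x. X x f) \<in> Cinf M)}"

definition vf_bracket :: "'m vfield \<Rightarrow> 'm vfield \<Rightarrow> 'm vfield" where
  "vf_bracket X Y = (\<lambda>x f. X x (\<lambda>y. Y y f) - Y x (\<lambda>y. X y f))"

definition vf_scale :: "('m \<Rightarrow> real) \<Rightarrow> 'm vfield \<Rightarrow> 'm vfield" where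
  "vf_scale f X = (\<lambda>x g. f x * X x g)"

section \<open>Vector bundles\<close>

text \<open>The fibres are subspaces of a common real vector space \<open>'v\<close>, with no relation between the
  fibres over different points. (This is no restriction: \<open>'v\<close> may be the direct sum of all fibres.)
  A local trivialization \<open>(U, r, \<Phi>)\<close> consists of linear isomorphisms \<open>\<Phi> x\<close> from the fibre over
  \<open>x \<in> U\<close> to Euclidean space of dimension \<open>r\<close>; thus the rank is locally constant.\<close>

type_synonym ('m, 'v) triv = "'m set \<times> nat \<times> ('m \<Rightarrow> 'v \<Rightarrow> nat \<Rightarrow> real)"

record ('m, 'v) vbundle = "'m manifold" +
  fibre :: "'m \<Rightarrow> 'v set"
  trivs :: "('m, 'v) triv set"

definition local_triv ::
    "('m::topological_space, 'v::real_vector, 'z) vbundle_scheme \<Rightarrow> ('m, 'v) triv \<Rightarrow> bool" where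
  "local_triv E = (\<lambda>(U, r, \<Phi>). open U \<and>
     (\<forall>x\<in>U. bij_betw (\<Phi> x) (fibre E x) (topspace (Euclidean_space r)) \<and>
        (\<forall>a\<in>fibre E x. \<forall>b\<in>fibre E x. \<forall>s t i.
           \<Phi> x (s *\<^sub>R a + t *\<^sub>R b) i = s * \<Phi> x a i + t * \<Phi> x b i)))"

text \<open>The matrix of the transition from \<open>\<Phi>\<close> to \<open>\<Psi>\<close> depends smoothly on the point.\<close>

definition smooth_transition ::
    "('m, 'v, 'z) vbundle_scheme \<Rightarrow> ('m, 'v) triv \<Rightarrow> ('m, 'v) triv \<Rightarrow> bool" where
  "smooth_transition E = (\<lambda>(U, r, \<Phi>) (V, s, \<Psi>). \<forall>i<s. \<forall>j<r.
     smooth_on E (U \<inter> V)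
       (\<lambda>x. \<Psi> x (inv_into (fibre E x) (\<Phi> x) (\<lambda>k. if k = j then 1 else 0)) i))"

definition vector_bundle ::
    "('m::{t2_space,second_countable_topology}, 'v::real_vector, 'z) vbundle_scheme \<Rightarrow> bool" where
  "vector_bundle E \<longleftrightarrow> smooth_manifold E \<and>
     (\<forall>x. subspace (fibre E x)) \<and>
     (\<Union>(U, r, \<Phi>)\<in>trivs E. U) = UNIV \<and>
     (\<forall>\<tau>\<in>trivs E. local_triv E \<tau>) \<and>
     (\<forall>\<sigma>\<in>trivs E. \<forall>\<tau>\<in>trivs E. smooth_transition E \<sigma> \<tau>)"

definition sections :: "('m, 'v, 'z) vbundle_scheme \<Rightarrow> ('m \<Rightarrow> 'v) set" where
  "sections E = {\<alpha>. (\<forall>x. \<alpha> x \<in> fibre E x) \<and>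
     (\<forall>(U, r, \<Phi>)\<in>trivs E. \<forall>i<r. smooth_on E U (\<lambda>x. \<Phi> x (\<alpha> x) i))}"

definition sec_scale :: "('m \<Rightarrow> real) \<Rightarrow> ('m \<Rightarrow> 'v::real_vector) \<Rightarrow> 'm \<Rightarrow> 'v" where
  "sec_scale f \<alpha> = (\<lambda>x. f x *\<^sub>R \<alpha> x)"

text \<open>A subbundle is given by its fibres; around each point it is the preimage of a coordinate
  subspace under a local trivialization of \<open>E\<close> compatible with the given ones.\<close>

definition subbundle ::
    "('m::topological_space, 'v::real_vector, 'z) vbundle_scheme \<Rightarrow> ('m \<Rightarrow> 'v set) \<Rightarrow> bool" where
  "subbundle E K \<longleftrightarrow> (\<forall>x. \<exists>U r \<Phi> s. x \<in> U \<and> s \<le> r \<and> local_triv E (U, r, \<Phi>) \<and>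
     (\<forall>\<tau>\<in>trivs E. smooth_transition E (U, r, \<Phi>) \<tau> \<and> smooth_transition E \<tau> (U, r, \<Phi>)) \<and>
     (\<forall>y\<in>U. K y = {a \<in> fibre E y. \<forall>i. s \<le> i \<and> i < r \<longrightarrow> \<Phi> y a i = 0}))"

definition sub_sections ::
    "('m, 'v, 'z) vbundle_scheme \<Rightarrow> ('m \<Rightarrow> 'v set) \<Rightarrow> ('m \<Rightarrow> 'v) set" where
  "sub_sections E K = {\<alpha>\<in>sections E. \<forall>x. \<alpha> x \<in> K x}"

section \<open>Lie algebroids and bundles of ideals\<close>

record ('m, 'v) algebroid = "('m, 'v) vbundle" +
  brk :: "('m \<Rightarrow> 'v) \<Rightarrow> ('m \<Rightarrow> 'v) \<Rightarrow> 'm \<Rightarrow> 'v"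
  anchor :: "'m \<Rightarrow> 'v \<Rightarrow> ('m \<Rightarrow> real) \<Rightarrow> real"

definition anchor_sec :: "('m, 'v, 'z) algebroid_scheme \<Rightarrow> ('m \<Rightarrow> 'v) \<Rightarrow> 'm vfield" where
  "anchor_sec A \<alpha> = (\<lambda>x. anchor A x (\<alpha> x))"

text \<open>The anchor is a smooth vector bundle map to the tangent bundle: it is linear on each fibre
  and maps smooth sections to smooth vector fields. That it preserves brackets is a consequence
  of the axioms.\<close>

definition lie_algebroid ::
    "('m::{t2_space,second_countable_topology}, 'v::real_vector, 'z) algebroid_scheme \<Rightarrow> bool" where
  "lie_algebroid A \<longleftrightarrow> vector_bundle A \<and>
     (\<forall>x. \<forall>a\<in>fibre A x. anchor A x a \<in> tangent_space A x) \<and>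
     (\<forall>x. \<forall>a\<in>fibre A x. \<forall>b\<in>fibre A x. \<forall>s t f.
        anchor A x (s *\<^sub>R a + t *\<^sub>R b) f = s * anchor A x a f + t * anchor A x b f) \<and>
     (\<forall>\<alpha>\<in>sections A. anchor_sec A \<alpha> \<in> vfields A) \<and>
     (\<forall>\<alpha>\<in>sections A. \<forall>\<beta>\<in>sections A. brk A \<alpha> \<beta> \<in> sections A) \<and>
     (\<forall>\<alpha>\<in>sections A. \<forall>\<beta>\<in>sections A. \<forall>\<gamma>\<in>sections A. \<forall>s t.
        brk A (\<lambda>x. s *\<^sub>R \<alpha> x + t *\<^sub>R \<beta> x) \<gamma> = (\<lambda>x. s *\<^sub>R brk A \<alpha> \<gamma> x + t *\<^sub>R brk A \<beta> \<gamma> x)) \<and>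
     (\<forall>\<alpha>\<in>sections A. \<forall>\<beta>\<in>sections A. brk A \<alpha> \<beta> = - brk A \<beta> \<alpha>) \<and>
     (\<forall>\<alpha>\<in>sections A. \<forall>\<beta>\<in>sections A. \<forall>\<gamma>\<in>sections A.
        brk A \<alpha> (brk A \<beta> \<gamma>) + brk A \<beta> (brk A \<gamma> \<alpha>) + brk A \<gamma> (brk A \<alpha> \<beta>) = 0) \<and>
     (\<forall>\<alpha>\<in>sections A. \<forall>\<beta>\<in>sections A. \<forall>f\<in>Cinf A.
        brk A \<alpha> (sec_scale f \<beta>) =
          sec_scale f (brk A \<alpha> \<beta>) + sec_scale (\<lambda>x. anchor_sec A \<alpha> x f) \<beta>)"

definition bundle_of_ideals ::
    "('m::topological_space, 'v::real_vector, 'z) algebroid_scheme \<Rightarrow> ('m \<Rightarrow> 'v set) \<Rightarrow> bool" where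
  "bundle_of_ideals A K \<longleftrightarrow> subbundle A K \<and>
     (\<forall>x. \<forall>a\<in>K x. anchor A x a = 0) \<and>
     (\<forall>\<alpha>\<in>sections A. \<forall>\<xi>\<in>sub_sections A K. brk A \<alpha> \<xi> \<in> sub_sections A K)"

section \<open>Differential forms with values in a bundle of ideals\<close>

text \<open>A form of degree \<open>q\<close> is an alternating map, multilinear over the smooth functions, from
  \<open>q\<close>-tuples of vector fields to sections. Tuples are lists; the values on lists that are not
  \<open>q\<close>-tuples of vector fields are irrelevant, so forms are only ever compared on \<open>tuples M q\<close>.
  A form of degree 0 is identified with its value at the empty list.\<close>

type_synonym ('m, 'v) form = "'m vfield list \<Rightarrow> 'm \<Rightarrow> 'v"

definition tuples :: "('m, 'z) manifold_scheme \<Rightarrow> nat \<Rightarrow> 'm vfield list set" where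
  "tuples M q = {Xs. length Xs = q \<and> set Xs \<subseteq> vfields M}"

definition forms ::
    "('m, 'v::real_vector, 'z) vbundle_scheme \<Rightarrow> ('m \<Rightarrow> 'v set) \<Rightarrow> nat \<Rightarrow> ('m, 'v) form set" where
  "forms E K q = {\<gamma>.
     (\<forall>Xs\<in>tuples E q. \<gamma> Xs \<in> sub_sections E K) \<and>
     (\<forall>Xs\<in>tuples E q. \<forall>i<q. \<forall>Y\<in>vfields E. \<forall>Z\<in>vfields E. \<forall>f\<in>Cinf E. \<forall>g\<in>Cinf E.
        \<gamma> (Xs[i := vf_scale f Y + vf_scale g Z]) =
          sec_scale f (\<gamma> (Xs[i := Y])) + sec_scale g (\<gamma> (Xs[i := Z]))) \<and>
     (\<forall>Xs\<in>tuples E q. \<forall>i<q. \<forall>j<q. i \<noteq> j \<and> Xs ! i = Xs ! j \<longrightarrow> \<gamma> Xs = 0)}"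

definition omit :: "nat \<Rightarrow> 'a list \<Rightarrow> 'a list" where
  "omit i xs = take i xs @ drop (Suc i) xs"

definition d_wedge :: "('m \<Rightarrow> real) \<Rightarrow> ('m, 'v::real_vector) form \<Rightarrow> ('m, 'v) form" where
  "d_wedge f \<gamma> = (\<lambda>Xs x. \<Sum>i<length Xs. ((-1) ^ i * (Xs ! i) x f) *\<^sub>R \<gamma> (omit i Xs) x)"

definition lie_deriv ::
    "('m, 'v::real_vector, 'z) algebroid_scheme \<Rightarrow> ('m \<Rightarrow> 'v) \<Rightarrow> ('m, 'v) form \<Rightarrow> ('m, 'v) form" where
  "lie_deriv A \<alpha> \<gamma> = (\<lambda>Xs. brk A \<alpha> (\<gamma> Xs) -
     (\<Sum>j<length Xs. \<gamma> (Xs[j := vf_bracket (anchor_sec A \<alpha>) (Xs ! j)])))"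

text \<open>The exterior covariant derivative of a linear connection \<open>nabla\<close>, by the Koszul formula.\<close>

definition ext_cov_deriv ::
    "('m vfield \<Rightarrow> ('m \<Rightarrow> 'v) \<Rightarrow> 'm \<Rightarrow> 'v::real_vector) \<Rightarrow> ('m, 'v) form \<Rightarrow> ('m, 'v) form" where
  "ext_cov_deriv nabla \<gamma> = (\<lambda>Xs x.
     (\<Sum>i<length Xs. (-1) ^ i *\<^sub>R nabla (Xs ! i) (\<gamma> (omit i Xs)) x) +
     (\<Sum>j<length Xs. \<Sum>i<j.
        (-1) ^ (i + j) *\<^sub>R \<gamma> (vf_bracket (Xs ! i) (Xs ! j) # omit i (omit j Xs)) x))"

section \<open>IM forms and IM connections\<close>

type_synonym ('m, 'v) cochain =
  "(('m \<Rightarrow> 'v) \<Rightarrow> ('m, 'v) form) \<times> (('m \<Rightarrow> 'v) \<Rightarrow> ('m, 'v) form)"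

text \<open>The conditions \<open>q = Suc p\<close>, \<open>q = Suc (Suc p)\<close> below reflect that there are no nonzero forms of
  negative degree.\<close>

definition weil ::
    "('m, 'v::real_vector, 'z) vbundle_scheme \<Rightarrow> ('m \<Rightarrow> 'v set) \<Rightarrow> nat \<Rightarrow> ('m, 'v) cochain set" where
  "weil A K q = {(c0, c1).
     (\<forall>\<alpha>\<in>sections A. c0 \<alpha> \<in> forms A K q) \<and>
     (\<forall>\<alpha>\<in>sections A. \<forall>\<beta>\<in>sections A. \<forall>s t. \<forall>Xs\<in>tuples A q.
        c0 (\<lambda>x. s *\<^sub>R \<alpha> x + t *\<^sub>R \<beta> x) Xs = (\<lambda>x. s *\<^sub>R c0 \<alpha> Xs x + t *\<^sub>R c0 \<beta> Xs x)) \<and>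
     (\<forall>p. q = Suc p \<longrightarrow>
        (\<forall>\<alpha>\<in>sections A. c1 \<alpha> \<in> forms A K p) \<and>
        (\<forall>\<alpha>\<in>sections A. \<forall>\<beta>\<in>sections A. \<forall>f\<in>Cinf A. \<forall>g\<in>Cinf A. \<forall>Xs\<in>tuples A p.
           c1 (sec_scale f \<alpha> + sec_scale g \<beta>) Xs =
             sec_scale f (c1 \<alpha> Xs) + sec_scale g (c1 \<beta> Xs))) \<and>
     (\<forall>\<alpha>\<in>sections A. \<forall>f\<in>Cinf A. \<forall>Xs\<in>tuples A q.
        c0 (sec_scale f \<alpha>) Xs = sec_scale f (c0 \<alpha> Xs) + d_wedge f (c1 \<alpha>) Xs)}"

text \<open>Equality of elements of \<open>weil A K q\<close>.\<close>

definition weil_eq ::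
    "('m, 'v, 'z) vbundle_scheme \<Rightarrow> nat \<Rightarrow> ('m, 'v) cochain \<Rightarrow> ('m, 'v) cochain \<Rightarrow> bool" where
  "weil_eq A q c c' \<longleftrightarrow> (\<forall>\<alpha>\<in>sections A.
     (\<forall>Xs\<in>tuples A q. fst c \<alpha> Xs = fst c' \<alpha> Xs) \<and>
     (\<forall>p. q = Suc p \<longrightarrow> (\<forall>Xs\<in>tuples A p. snd c \<alpha> Xs = snd c' \<alpha> Xs)))"

definition im_forms ::
    "('m, 'v::real_vector, 'z) algebroid_scheme \<Rightarrow> ('m \<Rightarrow> 'v set) \<Rightarrow> nat \<Rightarrow> ('m, 'v) cochain set" where
  "im_forms A K q = {(c0, c1). (c0, c1) \<in> weil A K q \<and>
     (\<forall>\<alpha>\<in>sections A. \<forall>\<beta>\<in>sections A.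
        (\<forall>Xs\<in>tuples A q.
           c0 (brk A \<alpha> \<beta>) Xs = lie_deriv A \<alpha> (c0 \<beta>) Xs - lie_deriv A \<beta> (c0 \<alpha>) Xs) \<and>
        (\<forall>p. q = Suc p \<longrightarrow> (\<forall>Xs\<in>tuples A p.
           c1 (brk A \<alpha> \<beta>) Xs = lie_deriv A \<alpha> (c1 \<beta>) Xs - c0 \<alpha> (anchor_sec A \<beta> # Xs))) \<and>
        (\<forall>p. q = Suc (Suc p) \<longrightarrow> (\<forall>Xs\<in>tuples A p.
           c1 \<beta> (anchor_sec A \<alpha> # Xs) = - c1 \<alpha> (anchor_sec A \<beta> # Xs))))}"

definition im_connections ::
    "('m, 'v::real_vector, 'z) algebroid_scheme \<Rightarrow> ('m \<Rightarrow> 'v set) \<Rightarrow> ('m, 'v) cochain set" where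
  "im_connections A K = {(C, v). (C, v) \<in> im_forms A K 1 \<and> (\<forall>\<xi>\<in>sub_sections A K. v \<xi> [] = \<xi>)}"

definition induced_conn :: "('m, 'v) cochain \<Rightarrow> 'm vfield \<Rightarrow> ('m \<Rightarrow> 'v) \<Rightarrow> 'm \<Rightarrow> 'v" where
  "induced_conn = (\<lambda>(C, v) X \<xi>. C \<xi> [X])"

definition hor_proj :: "('m, 'v::real_vector) cochain \<Rightarrow> ('m \<Rightarrow> 'v) \<Rightarrow> 'm \<Rightarrow> 'v" where
  "hor_proj = (\<lambda>(C, v) \<beta>. \<beta> - v \<beta> [])"

definition kappa ::
    "('m, 'v::real_vector) cochain \<Rightarrow> ('m, 'v) cochain \<Rightarrow> ('m \<Rightarrow> 'v) \<Rightarrow> ('m, 'v) form" where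
  "kappa Cv = (\<lambda>(c0, c1) \<beta>. c0 \<beta> - ext_cov_deriv (induced_conn Cv) (c1 \<beta>))"

definition dot_wedge ::
    "(('m \<Rightarrow> 'v::real_vector) \<Rightarrow> ('m, 'v) form) \<Rightarrow> ('m, 'v) form \<Rightarrow> ('m, 'v) form" where
  "dot_wedge \<kappa> \<theta> = (\<lambda>Xs x. \<Sum>i<length Xs. (-1) ^ i *\<^sub>R \<kappa> (\<theta> [Xs ! i]) (omit i Xs) x)"

definition hor_ext_cov_deriv ::
    "('m, 'v::real_vector) cochain \<Rightarrow> ('m, 'v) cochain \<Rightarrow> ('m, 'v) cochain" where
  "hor_ext_cov_deriv Cv c =
     (\<lambda>\<alpha>. ext_cov_deriv (induced_conn Cv) (fst c \<alpha>) - dot_wedge (kappa Cv c) (fst Cv \<alpha>),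
      \<lambda>\<beta>. kappa Cv c (hor_proj Cv \<beta>))"

definition im_curvature :: "('m, 'v::real_vector) cochain \<Rightarrow> ('m, 'v) cochain" where
  "im_curvature Cv = hor_ext_cov_deriv Cv Cv"

end

theory Submission
  imports Defs
begin

text \<open>
  As \<open>v\<close> is the identity on \<open>\<kk>\<close>, the map \<open>\<kappa>\<close> of \<open>(C, v)\<close> vanishes on \<open>\<kk>\<close>, so the curvature is \<open>(d\<^sup>\<nabla> C, C h)\<close>.
  The map \<open>\<kappa>\<close> of the curvature is therefore \<open>d\<^sup>\<nabla> d\<^sup>\<nabla> v\<close>, which vanishes on \<open>h \<beta>\<close>. What remains is
  the identity \<open>d\<^sup>\<nabla> d\<^sup>\<nabla> \<gamma> = R\<^sup>\<nabla> \<and> \<gamma>\<close> for the one-form \<open>\<gamma> = C \<alpha>\<close>, where \<open>R\<^sup>\<nabla> \<xi> = d\<^sup>\<nabla> d\<^sup>\<nabla> \<xi>\<close>.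
\<close>

section \<open>Algebra of smooth functions\<close>

lemma Euclidean_space_eq_top_of_set:
  "Euclidean_space n = top_of_set {x. \<forall>i\<ge>n. x i = (0::real)}"
  by (simp add: Euclidean_space_def euclidean_product_topology)

text \<open>\<open>S\<close> is open only relative to the sequences vanishing from index
  \<open>n\<close> on. Varying a coordinate \<open>i < n\<close> stays among these sequences, so a
  short piece of the coordinate line lies in \<open>S\<close>. Hence partial derivatives at points
  of \<open>S\<close> depend only on values on \<open>S\<close>.\<close>

lemma eventually_coordinate_line:
  fixes x :: "nat \<Rightarrow> real"
  assumes "openin (Euclidean_space n) S" "x \<in> S" "i < n"
  shows "eventually (\<lambda>t. x(i := t) \<in> S) (nhds (x i))"
proof -
  obtain T where T: "open T" "S = {x. \<forall>i\<ge>n. x i = 0} \<inter> T"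
    using assms(1) by (auto simp: Euclidean_space_eq_top_of_set openin_open)
  have "continuous_on UNIV (\<lambda>t. (x(i := t)) j)" for j
    by (cases "j = i") auto
  then have "continuous_on UNIV (\<lambda>t. x(i := t))"
    by (rule continuous_on_coordinatewise_then_product)
  then have "open ((\<lambda>t. x(i := t)) -` T)"
    using T(1) by (simp add: continuous_on_open_vimage)
  moreover have "x i \<in> (\<lambda>t. x(i := t)) -` T"
    using T assms by simp
  moreover have "x(i := t) \<in> S" if "t \<in> (\<lambda>t. x(i := t)) -` T" for t
    using that T assms by auto
  ultimately show ?thesis
    unfolding eventually_nhds by blast
qed

text \<open>Near \<open>x i\<close> the coordinate line stays in \<open>S\<close>, so equality on
  \<open>S\<close> passes to differentiability and to partial derivatives, and induction on the
  order applies. This permits the use of differentiation rules that are valid on \<open>S\<close>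
  only.\<close>

lemma Ck_on_cong:
  assumes S: "openin (Euclidean_space n) S"
    and "\<And>x. x \<in> S \<Longrightarrow> f x = g x" "Ck_on n S k f"
  shows "Ck_on n S k g"
  using assms(2,3)
proof (induction k arbitrary: f g)
  case 0
  then show ?case by (metis Ck_on.simps(1) continuous_on_cong)
next
  case (Suc k)
  have ev: "eventually (\<lambda>t. f (x(i := t)) = g (x(i := t))) (nhds (x i))"
    if "x \<in> S" "i < n" for x i
    using eventually_coordinate_line[OF S that] by (rule eventually_mono) (rule Suc.prems(1))
  have "(\<lambda>t. g (x(i := t))) differentiable (at (x i))" if "x \<in> S" "i < n" for x i
  proof -
    have "(\<lambda>t. f (x(i := t))) differentiable (at (x i))"
      using Suc.prems(2) that by auto
    then obtain D where D: "((\<lambda>t. f (x(i := t))) has_derivative D) (at (x i))"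
      unfolding differentiable_def by blast
    have "eventually (\<lambda>t. f (x(i := t)) = g (x(i := t))) (at (x i))"
      using ev[OF that] by (simp add: eventually_nhds_conv_at)
    from has_derivative_transform_eventually[OF D this] show ?thesis
      using Suc.prems(1)[OF that(1)] by (auto simp: differentiable_def)
  qed
  moreover have "Ck_on n S k (partial_deriv i g)" if "i < n" for i
  proof (rule Suc.IH)
    show "Ck_on n S k (partial_deriv i f)"
      using Suc.prems(2) that by auto
    show "partial_deriv i f x = partial_deriv i g x" if "x \<in> S" for x
      unfolding partial_deriv_def by (rule deriv_cong_ev[OF ev[OF that \<open>i < n\<close>] refl])
  qed
  moreover have "continuous_on S g"
    using Suc.prems by (metis Ck_on.simps(2) continuous_on_cong)
  ultimately show ?case by auto
qed

lemma Ck_on_SucD: "Ck_on n S (Suc k) f \<Longrightarrow> Ck_on n S k f"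
proof (induction k arbitrary: f)
  case (Suc k)
  then show ?case
    using Ck_on.simps(2)[of n S "Suc k" f] Ck_on.simps(2)[of n S k f] by blast
qed simp

lemma Ck_on_const: "Ck_on n S k (\<lambda>x. c)"
proof (induction k arbitrary: c)
  case (Suc k)
  have "partial_deriv i (\<lambda>x. c) = (\<lambda>x. 0)" for i
    by (simp add: partial_deriv_def fun_eq_iff)
  then show ?case using Suc by simp
qed simp

lemma Ck_on_lincomb:
  assumes S: "openin (Euclidean_space n) S" and "Ck_on n S k f" "Ck_on n S k g"
  shows "Ck_on n S k (\<lambda>x. a * f x + b * g x)"
  using assms(2,3)
proof (induction k arbitrary: f g)
  case 0
  then show ?case by (auto intro!: continuous_intros)
next
  case (Suc k)
  have d: "(\<lambda>t. f (x(i := t))) differentiable (at (x i))"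
    "(\<lambda>t. g (x(i := t))) differentiable (at (x i))" if "x \<in> S" "i < n" for x i
    using Suc.prems that by auto
  \<comment> \<open>The functions are known to be differentiable only on \<open>S\<close>, so the
    rule for the derivative is an equality on \<open>S\<close> and not of functions.\<close>
  have "Ck_on n S k (partial_deriv i (\<lambda>x. a * f x + b * g x))" if i: "i < n" for i
  proof (rule Ck_on_cong[OF S])
    show "Ck_on n S k (\<lambda>x. a * partial_deriv i f x + b * partial_deriv i g x)"
      using Suc.prems i by (auto intro: Suc.IH)
    show "a * partial_deriv i f x + b * partial_deriv i g x =
        partial_deriv i (\<lambda>x. a * f x + b * g x) x" if x: "x \<in> S" for x
    proof -
      obtain f' g' where "((\<lambda>t. f (x(i := t))) has_real_derivative f') (at (x i))"
        "((\<lambda>t. g (x(i := t))) has_real_derivative g') (at (x i))"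
        using d[OF x i] unfolding real_differentiable_def by blast
      then show ?thesis
        unfolding partial_deriv_def
        by (auto simp: DERIV_imp_deriv intro!: DERIV_imp_deriv[symmetric] derivative_eq_intros)
    qed
  qed
  moreover have "(\<lambda>t. a * f (x(i := t)) + b * g (x(i := t))) differentiable (at (x i))"
    if "x \<in> S" "i < n" for x i
    using d[OF that] by (auto intro!: derivative_intros)
  ultimately show ?case
    using Suc.prems by (auto intro!: continuous_intros)
qed

lemma Ck_on_mult:
  assumes S: "openin (Euclidean_space n) S" and "Ck_on n S k f" "Ck_on n S k g"
  shows "Ck_on n S k (\<lambda>x. f x * g x)"
  using assms(2,3)
proof (induction k arbitrary: f g)
  case 0
  then show ?case by (auto intro!: continuous_intros)
next
  case (Suc k)
  have d: "(\<lambda>t. f (x(i := t))) differentiable (at (x i))"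
    "(\<lambda>t. g (x(i := t))) differentiable (at (x i))" if "x \<in> S" "i < n" for x i
    using Suc.prems that by auto
  have "Ck_on n S k (partial_deriv i (\<lambda>x. f x * g x))" if i: "i < n" for i
  proof (rule Ck_on_cong[OF S])
    \<comment> \<open>In each Leibniz term the undifferentiated factor has order
      \<open>Suc k\<close>; it is lowered to \<open>k\<close> to fit the induction
      hypothesis.\<close>
    have "Ck_on n S k (\<lambda>x. f x * partial_deriv i g x)"
      "Ck_on n S k (\<lambda>x. partial_deriv i f x * g x)"
      using Suc.prems i Ck_on_SucD[OF Suc.prems(1)] Ck_on_SucD[OF Suc.prems(2)]
      by (auto intro: Suc.IH)
    then show "Ck_on n S k (\<lambda>x. 1 * (f x * partial_deriv i g x) + 1 * (partial_deriv i f x * g x))"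
      by (rule Ck_on_lincomb[OF S])
    show "1 * (f x * partial_deriv i g x) + 1 * (partial_deriv i f x * g x) =
        partial_deriv i (\<lambda>x. f x * g x) x" if x: "x \<in> S" for x
    proof -
      obtain f' g' where "((\<lambda>t. f (x(i := t))) has_real_derivative f') (at (x i))"
        "((\<lambda>t. g (x(i := t))) has_real_derivative g') (at (x i))"
        using d[OF x i] unfolding real_differentiable_def by blast
      then show ?thesis
        unfolding partial_deriv_def
        by (auto simp: DERIV_imp_deriv intro!: DERIV_imp_deriv[symmetric] derivative_eq_intros)
    qed
  qed
  moreover have "(\<lambda>t. f (x(i := t)) * g (x(i := t))) differentiable (at (x i))"
    if "x \<in> S" "i < n" for x i
    using d[OF that] by (auto intro!: derivative_intros)
  ultimately show ?case
    using Suc.prems by (auto intro!: continuous_intros)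
qed

section \<open>Smooth functions on the manifold, read in charts\<close>

lemma openin_chart_image:
  assumes "smooth_manifold M" "(U, \<phi>) \<in> charts M" "open W"
  shows "openin (Euclidean_space (mdim M)) (\<phi> ` (U \<inter> W))"
proof -
  have o: "openin (Euclidean_space (mdim M)) (\<phi> ` U)"
    and h: "homeomorphism U (\<phi> ` U) \<phi> (inv_into U \<phi>)"
    using assms(1,2) unfolding smooth_manifold_def by auto
  have "openin (top_of_set (\<phi> ` U)) (\<phi> ` (U \<inter> W))"
    using homeomorphism_imp_open_map[OF h] assms(3) by (simp add: openin_open_Int)
  with o show ?thesis
    unfolding Euclidean_space_eq_top_of_set by (rule openin_trans[rotated])
qed

lemma smooth_on_const: "smooth_on M W (\<lambda>x. c)"
  by (auto simp: smooth_on_def Cinf_on_def Ck_on_const)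

lemma smooth_on_lincomb:
  assumes "smooth_manifold M" "open W" "smooth_on M W f" "smooth_on M W g"
  shows "smooth_on M W (\<lambda>x. a * f x + b * g x)"
  using assms(3,4) openin_chart_image[OF assms(1) _ assms(2)]
  unfolding smooth_on_def Cinf_on_def by (fast intro: Ck_on_lincomb)

lemma smooth_on_mult:
  assumes "smooth_manifold M" "open W" "smooth_on M W f" "smooth_on M W g"
  shows "smooth_on M W (\<lambda>x. f x * g x)"
  using assms(3,4) openin_chart_image[OF assms(1) _ assms(2)]
  unfolding smooth_on_def Cinf_on_def by (fast intro: Ck_on_mult)

lemma Cinf_const: "(\<lambda>x. c) \<in> Cinf M"
  by (simp add: Cinf_def smooth_on_const)

lemma Cinf_lincomb:
  "smooth_manifold M \<Longrightarrow> f \<in> Cinf M \<Longrightarrow> g \<in> Cinf M \<Longrightarrow> (\<lambda>x. a * f x + b * g x) \<in> Cinf M"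
  by (simp add: Cinf_def smooth_on_lincomb)

lemma Cinf_mult:
  "smooth_manifold M \<Longrightarrow> f \<in> Cinf M \<Longrightarrow> g \<in> Cinf M \<Longrightarrow> (\<lambda>x. f x * g x) \<in> Cinf M"
  by (simp add: Cinf_def smooth_on_mult)

section \<open>The Lie algebra of vector fields\<close>

lemma vfields_Cinf: "X \<in> vfields M \<Longrightarrow> f \<in> Cinf M \<Longrightarrow> (\<lambda>x. X x f) \<in> Cinf M"
  by (simp add: vfields_def)

lemma vfields_lincomb_apply:
  "X \<in> vfields M \<Longrightarrow> f \<in> Cinf M \<Longrightarrow> g \<in> Cinf M \<Longrightarrow>
    X x (\<lambda>y. a * f y + b * g y) = a * X x f + b * X x g"
  by (simp add: vfields_def tangent_space_def)

lemma vfields_diff_apply: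
  "X \<in> vfields M \<Longrightarrow> f \<in> Cinf M \<Longrightarrow> g \<in> Cinf M \<Longrightarrow> X x (\<lambda>y. f y - g y) = X x f - X x g"
  using vfields_lincomb_apply[of X M f g x 1 "-1"] by simp

lemma vfields_mult_apply:
  "X \<in> vfields M \<Longrightarrow> f \<in> Cinf M \<Longrightarrow> g \<in> Cinf M \<Longrightarrow>
    X x (\<lambda>y. f y * g y) = f x * X x g + g x * X x f"
  by (simp add: vfields_def tangent_space_def)

lemma vfields_not_smooth: "X \<in> vfields M \<Longrightarrow> f \<notin> Cinf M \<Longrightarrow> X x f = 0"
  by (simp add: vfields_def tangent_space_def)

lemma vfields_zero_apply: "X \<in> vfields M \<Longrightarrow> X x (\<lambda>y. 0) = 0"
  using vfields_lincomb_apply[of X M "\<lambda>y. 0" "\<lambda>y. 0" x 0 0] by (simp add: Cinf_const)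

lemma vf_bracket_vfields:
  assumes M: "smooth_manifold M" and X: "X \<in> vfields M" and Y: "Y \<in> vfields M"
  shows "vf_bracket X Y \<in> vfields M"
proof -
  have lin: "vf_bracket X Y x (\<lambda>y. a * f y + b * g y) =
      a * vf_bracket X Y x f + b * vf_bracket X Y x g"
    if "f \<in> Cinf M" "g \<in> Cinf M" for x f g a b
    using that
    by (simp add: vf_bracket_def vfields_lincomb_apply[OF X] vfields_lincomb_apply[OF Y]
        vfields_Cinf[OF X] vfields_Cinf[OF Y] algebra_simps)
  have prod: "vf_bracket X Y x (\<lambda>y. f y * g y) =
      f x * vf_bracket X Y x g + g x * vf_bracket X Y x f"
    if fg: "f \<in> Cinf M" "g \<in> Cinf M" for x f g
  proof -
    \<comment> \<open>Here \<open>V\<close> is applied to the Leibniz expansion of \<open>W\<close>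
      on \<open>f g\<close>. The two mixed terms, products of first derivatives, are symmetric in
      \<open>V\<close> and \<open>W\<close> and cancel in the commutator.\<close>
    have *: "V x (\<lambda>y. f y * W y g + g y * W y f) =
        f x * V x (\<lambda>y. W y g) + W x g * V x f + (g x * V x (\<lambda>y. W y f) + W x f * V x g)"
      if "V \<in> vfields M" "W \<in> vfields M" for V W
      using vfields_lincomb_apply[of V M "\<lambda>y. f y * W y g" "\<lambda>y. g y * W y f" x 1 1] fg
      by (simp add: that that[THEN vfields_mult_apply] that[THEN vfields_Cinf] Cinf_mult[OF M])
    show ?thesis
      using fg X Y by (simp add: vf_bracket_def vfields_mult_apply[of _ M] * algebra_simps)
  qed
  have "(\<lambda>x. vf_bracket X Y x f) \<in> Cinf M" if "f \<in> Cinf M" for f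
    using Cinf_lincomb[OF M, of "\<lambda>x. X x (\<lambda>y. Y y f)" "\<lambda>x. Y x (\<lambda>y. X y f)" 1 "-1"]
      X Y that by (simp add: vf_bracket_def vfields_Cinf)
  \<comment> \<open>On a non-smooth \<open>f\<close> the inner field gives the zero function, which
    is smooth and is sent to 0 by the outer field.\<close>
  moreover have "vf_bracket X Y x f = 0" if "f \<notin> Cinf M" for x f
    using X Y that by (simp add: vf_bracket_def vfields_not_smooth[of _ M] vfields_zero_apply[of _ M])
  ultimately show ?thesis
    using lin prod by (simp add: vfields_def tangent_space_def)
qed

text \<open>The Jacobi identity, arranged for the order in which iterated brackets arise in the
  Koszul formula for a twice differentiated one-form.\<close>

lemma vf_bracket_jacobi:
  assumes "X \<in> vfields M" "Y \<in> vfields M" "Z \<in> vfields M"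
  shows "vf_bracket (vf_bracket X Z) Y = vf_bracket (vf_bracket X Y) Z + vf_bracket (vf_bracket Y Z) X"
proof (intro ext)
  fix x f
  show "vf_bracket (vf_bracket X Z) Y x f =
    (vf_bracket (vf_bracket X Y) Z + vf_bracket (vf_bracket Y Z) X) x f"
  \<comment> \<open>Vector fields are additive on smooth functions; on any other function both sides
    are 0 by the extension convention.\<close>
  proof (cases "f \<in> Cinf M")
    case True
    then show ?thesis
      by (simp add: vf_bracket_def assms[THEN vfields_diff_apply] assms[THEN vfields_Cinf])
  next
    case False
    then show ?thesis
      using assms by (simp add: vf_bracket_def vfields_not_smooth[of _ M] vfields_zero_apply[of _ M])
  qed
qed

section \<open>Sections and forms\<close>

text \<open>Trivializations are linear on fibres, so the components of the difference are
  differences of smooth components. This makes \<open>h\<close> map sections to sections.\<close>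

lemma sections_diff:
  assumes E: "vector_bundle E" and \<alpha>: "\<alpha> \<in> sections E" and \<beta>: "\<beta> \<in> sections E"
  shows "\<alpha> - \<beta> \<in> sections E"
proof -
  have M: "smooth_manifold E" and sub: "\<And>x. subspace (fibre E x)"
    and tr: "\<And>\<tau>. \<tau> \<in> trivs E \<Longrightarrow> local_triv E \<tau>"
    using E by (auto simp: vector_bundle_def)
  have fib: "\<alpha> x \<in> fibre E x" "\<beta> x \<in> fibre E x" for x
    using \<alpha> \<beta> by (auto simp: sections_def)
  have "smooth_on E U (\<lambda>x. \<Phi> x ((\<alpha> - \<beta>) x) i)" if \<tau>: "(U, r, \<Phi>) \<in> trivs E" "i < r" for U r \<Phi> i
  proof -
    have U: "open U" using tr[OF \<tau>(1)] by (simp add: local_triv_def)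
    have eq: "\<Phi> x ((\<alpha> - \<beta>) x) i = 1 * \<Phi> x (\<alpha> x) i + (-1) * \<Phi> x (\<beta> x) i" if "x \<in> U" for x
    proof -
      have "\<Phi> x (1 *\<^sub>R \<alpha> x + (-1) *\<^sub>R \<beta> x) i = 1 * \<Phi> x (\<alpha> x) i + (-1) * \<Phi> x (\<beta> x) i"
        using tr[OF \<tau>(1)] that fib unfolding local_triv_def by blast
      then show ?thesis by simp
    qed
    have s: "smooth_on E U (\<lambda>x. 1 * \<Phi> x (\<alpha> x) i + (-1) * \<Phi> x (\<beta> x) i)"
      using \<alpha> \<beta> \<tau> by (intro smooth_on_lincomb[OF M U]) (auto simp: sections_def)
    \<comment> \<open>The component formula \<open>eq\<close> holds over \<open>U\<close> only, so
      it is transferred chart by chart with \<open>Ck_on_cong\<close> on the image of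
      \<open>V \<inter> U\<close>.\<close>
    show ?thesis
      unfolding smooth_on_def
    proof (clarify)
      fix V \<phi> assume c: "(V, \<phi>) \<in> charts E"
      have "homeomorphism V (\<phi> ` V) \<phi> (inv_into V \<phi>)"
        using M c by (auto simp: smooth_manifold_def)
      then have U': "inv_into V \<phi> y \<in> U" if "y \<in> \<phi> ` (V \<inter> U)" for y
        using that by (auto simp: homeomorphism_apply1)
      show "Cinf_on (mdim E) (\<phi> ` (V \<inter> U)) (\<lambda>y. \<Phi> (inv_into V \<phi> y) ((\<alpha> - \<beta>) (inv_into V \<phi> y)) i)"
        unfolding Cinf_on_def
      proof
        fix k
        show "Ck_on (mdim E) (\<phi> ` (V \<inter> U)) k (\<lambda>y. \<Phi> (inv_into V \<phi> y) ((\<alpha> - \<beta>) (inv_into V \<phi> y)) i)"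
          by (rule Ck_on_cong[OF openin_chart_image[OF M c U] eq[OF U', symmetric]], assumption)
             (use s c in \<open>auto simp: smooth_on_def Cinf_on_def\<close>)
      qed
    qed
  qed
  moreover have "(\<alpha> - \<beta>) x \<in> fibre E x" for x
    using fib sub by (simp add: subspace_diff)
  ultimately show ?thesis by (auto simp: sections_def)
qed

lemma forms_1_add:
  assumes "\<gamma> \<in> forms E K 1" "Y \<in> vfields E" "Z \<in> vfields E"
  shows "\<gamma> [Y + Z] = \<gamma> [Y] + \<gamma> [Z]"
proof -
  have "\<forall>Xs\<in>tuples E 1. \<forall>i<1. \<forall>Y\<in>vfields E. \<forall>Z\<in>vfields E. \<forall>f\<in>Cinf E. \<forall>g\<in>Cinf E.
      \<gamma> (Xs[i := vf_scale f Y + vf_scale g Z]) =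
        sec_scale f (\<gamma> (Xs[i := Y])) + sec_scale g (\<gamma> (Xs[i := Z]))"
    using assms(1) unfolding forms_def by blast
  \<comment> \<open>The list \<open>[Y]\<close> only provides a slot, since updating position 0
    overwrites its single entry; both coefficient functions are the constant 1.\<close>
  from this[rule_format, of "[Y]" 0 Y Z "\<lambda>x. 1" "\<lambda>x. 1"] show ?thesis
    using assms(2,3) by (simp add: tuples_def Cinf_const vf_scale_def sec_scale_def)
qed

section \<open>The square of the exterior covariant derivative\<close>

text \<open>Only forms of degree 0, 1 and 2 are differentiated in the proof. In these degrees the
  Koszul sums are written out once, with their signs.\<close>

lemma ext_cov_deriv_0: "ext_cov_deriv nabla \<gamma> [X] = nabla X (\<gamma> [])"
  by (simp add: ext_cov_deriv_def omit_def)

lemma ext_cov_deriv_1: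
  "ext_cov_deriv nabla \<gamma> [X, Y] = nabla X (\<gamma> [Y]) - nabla Y (\<gamma> [X]) - \<gamma> [vf_bracket X Y]"
  by (simp add: ext_cov_deriv_def omit_def fun_eq_iff lessThan_nat_numeral numeral_2_eq_2
      lessThan_Suc)

lemma ext_cov_deriv_2:
  "ext_cov_deriv nabla \<gamma> [X, Y, Z] =
    nabla X (\<gamma> [Y, Z]) - nabla Y (\<gamma> [X, Z]) + nabla Z (\<gamma> [X, Y])
    - \<gamma> [vf_bracket X Y, Z] + \<gamma> [vf_bracket X Z, Y] - \<gamma> [vf_bracket Y Z, X]"
  by (simp add: ext_cov_deriv_def omit_def fun_eq_iff numeral_3_eq_3 numeral_2_eq_2
      lessThan_Suc)

lemma dot_wedge_1: "dot_wedge \<kappa> \<theta> [X, Y] = \<kappa> (\<theta> [X]) [Y] - \<kappa> (\<theta> [Y]) [X]"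
  by (simp add: dot_wedge_def omit_def fun_eq_iff numeral_2_eq_2 lessThan_Suc)

lemma dot_wedge_2:
  "dot_wedge \<kappa> \<theta> [X, Y, Z] = \<kappa> (\<theta> [X]) [Y, Z] - \<kappa> (\<theta> [Y]) [X, Z] + \<kappa> (\<theta> [Z]) [X, Y]"
  by (simp add: dot_wedge_def omit_def fun_eq_iff numeral_3_eq_3 numeral_2_eq_2 lessThan_Suc)

text \<open>The form \<open>\<lambda>_. \<xi>\<close> is \<open>\<xi>\<close> as a form of degree 0,
  so its second derivative at \<open>[Y, Z]\<close> is the curvature of \<open>nabla\<close> at
  \<open>Y\<close>, \<open>Z\<close> applied to \<open>\<xi>\<close>. In the expansion of the left
  side the terms applying \<open>nabla\<close> to \<open>\<gamma>\<close> of a bracket cancel in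
  pairs, the terms with two derivatives and those along a bracket form the curvature, and the
  iterated brackets cancel. The set \<open>L\<close> is a domain of \<open>nabla\<close> closed
  under all operations that occur.\<close>

lemma ext_cov_deriv_square:
  fixes M :: "('m::{t2_space,second_countable_topology}, 'v::real_vector, 'z) vbundle_scheme"
    and nabla :: "'m vfield \<Rightarrow> ('m \<Rightarrow> 'v) \<Rightarrow> 'm \<Rightarrow> 'v"
  assumes M: "smooth_manifold M"
    and diff: "\<And>X \<xi> \<eta>. X \<in> vfields M \<Longrightarrow> \<xi> \<in> L \<Longrightarrow> \<eta> \<in> L \<Longrightarrow> nabla X (\<xi> - \<eta>) = nabla X \<xi> - nabla X \<eta>"
    and L: "\<And>\<xi> \<eta>. \<xi> \<in> L \<Longrightarrow> \<eta> \<in> L \<Longrightarrow> \<xi> - \<eta> \<in> L"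
    and nabla: "\<And>X \<xi>. X \<in> vfields M \<Longrightarrow> \<xi> \<in> L \<Longrightarrow> nabla X \<xi> \<in> L"
    and \<gamma>: "\<gamma> \<in> forms M K 1" and \<gamma>L: "\<And>X. X \<in> vfields M \<Longrightarrow> \<gamma> [X] \<in> L"
    and X: "X \<in> vfields M" and Y: "Y \<in> vfields M" and Z: "Z \<in> vfields M"
  shows "ext_cov_deriv nabla (ext_cov_deriv nabla \<gamma>) [X, Y, Z] =
    dot_wedge (\<lambda>\<xi>. ext_cov_deriv nabla (ext_cov_deriv nabla (\<lambda>_. \<xi>))) \<gamma> [X, Y, Z]"
proof -
  note br = vf_bracket_vfields[OF M]
  \<comment> \<open>The terms of \<open>\<gamma>\<close> on iterated brackets cancel by Jacobi and
    additivity; all other terms match after expansion.\<close>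
  have "\<gamma> [vf_bracket (vf_bracket X Z) Y] =
      \<gamma> [vf_bracket (vf_bracket X Y) Z] + \<gamma> [vf_bracket (vf_bracket Y Z) X]"
    using X Y Z by (simp add: vf_bracket_jacobi[of X M Y Z] forms_1_add[OF \<gamma>] br)
  then show ?thesis
    using X Y Z
    by (simp add: ext_cov_deriv_2 ext_cov_deriv_1 ext_cov_deriv_0 dot_wedge_2
        diff L nabla \<gamma>L br)
qed

lemma kappa_apply:
  "kappa Cv c \<beta> Xs = fst c \<beta> Xs - ext_cov_deriv (induced_conn Cv) (snd c \<beta>) Xs"
  by (cases c) (simp add: kappa_def)

section \<open>Curvature of an IM connection\<close>

text \<open>In degree 1 the form \<open>v \<alpha>\<close> has degree 0, so \<open>v\<close> acts as
  the projection sending \<open>\<alpha>\<close> to \<open>v \<alpha> []\<close>, and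
  \<open>h\<close> is the complementary projection.\<close>

locale im_conn =
  fixes A :: "('m::{t2_space,second_countable_topology}, 'v::real_vector, 'z) vbundle_scheme"
    and K :: "'m \<Rightarrow> 'v set"
    and C v :: "('m \<Rightarrow> 'v) \<Rightarrow> ('m, 'v) form"
  assumes bundle_A: "vector_bundle A"
    and weil: "(C, v) \<in> weil A K 1"
    and v_id: "\<And>\<xi>. \<xi> \<in> sub_sections A K \<Longrightarrow> v \<xi> [] = \<xi>"
begin

section \<open>Elementary properties of C, v and h\<close>

abbreviation "nab \<equiv> induced_conn (C, v)"
abbreviation "h \<equiv> hor_proj (C, v)"

lemma manifold: "smooth_manifold A"
  using bundle_A by (simp add: vector_bundle_def)

lemma nab_eq: "nab X \<xi> = C \<xi> [X]"
  by (simp add: induced_conn_def)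

lemma h_eq: "h \<beta> = \<beta> - v \<beta> []"
  by (simp add: hor_proj_def)

lemma sub_sectionsD: "\<xi> \<in> sub_sections A K \<Longrightarrow> \<xi> \<in> sections A"
  by (simp add: sub_sections_def)

lemma C_forms: "\<alpha> \<in> sections A \<Longrightarrow> C \<alpha> \<in> forms A K 1"
  using weil by (simp add: weil_def)

lemma C_sub: "\<alpha> \<in> sections A \<Longrightarrow> X \<in> vfields A \<Longrightarrow> C \<alpha> [X] \<in> sub_sections A K"
  using C_forms[of \<alpha>] by (simp add: forms_def tuples_def)

lemma C_sec: "\<alpha> \<in> sections A \<Longrightarrow> X \<in> vfields A \<Longrightarrow> C \<alpha> [X] \<in> sections A"
  using C_sub sub_sectionsD by blast

lemma v_sub: "\<alpha> \<in> sections A \<Longrightarrow> v \<alpha> [] \<in> sub_sections A K"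
  using weil by (simp add: weil_def forms_def tuples_def)

lemma C_diff:
  assumes "\<alpha> \<in> sections A" "\<beta> \<in> sections A" "X \<in> vfields A"
  shows "C (\<alpha> - \<beta>) [X] = C \<alpha> [X] - C \<beta> [X]"
proof -
  have "\<forall>\<alpha>\<in>sections A. \<forall>\<beta>\<in>sections A. \<forall>s t. \<forall>Xs\<in>tuples A 1.
      C (\<lambda>x. s *\<^sub>R \<alpha> x + t *\<^sub>R \<beta> x) Xs = (\<lambda>x. s *\<^sub>R C \<alpha> Xs x + t *\<^sub>R C \<beta> Xs x)"
    using weil unfolding weil_def by blast
  from this[rule_format, of \<alpha> \<beta> "[X]" 1 "-1"] show ?thesis
    using assms by (simp add: tuples_def fun_diff_def)
qed

lemma v_diff:
  assumes "\<alpha> \<in> sections A" "\<beta> \<in> sections A"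
  shows "v (\<alpha> - \<beta>) [] = v \<alpha> [] - v \<beta> []"
proof -
  \<comment> \<open>The clause on the second component is guarded by \<open>q = Suc p\<close>; with
    1 read as \<open>Suc 0\<close> it applies for \<open>p = 0\<close>.\<close>
  have "\<forall>\<alpha>\<in>sections A. \<forall>\<beta>\<in>sections A. \<forall>f\<in>Cinf A. \<forall>g\<in>Cinf A. \<forall>Xs\<in>tuples A 0.
      v (sec_scale f \<alpha> + sec_scale g \<beta>) Xs = sec_scale f (v \<alpha> Xs) + sec_scale g (v \<beta> Xs)"
    using weil unfolding weil_def One_nat_def by blast
  from this[rule_format, of \<alpha> \<beta> "\<lambda>x. 1" "\<lambda>x. -1" "[]"]
  have "v (sec_scale (\<lambda>x. 1) \<alpha> + sec_scale (\<lambda>x. -1) \<beta>) [] =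
      sec_scale (\<lambda>x. 1) (v \<alpha> []) + sec_scale (\<lambda>x. -1) (v \<beta> [])"
    using assms by (simp add: tuples_def Cinf_const)
  moreover have "sec_scale (\<lambda>x. 1) \<xi> + sec_scale (\<lambda>x. -1) \<eta> = \<xi> - \<eta>" for \<xi> \<eta> :: "'m \<Rightarrow> 'v"
    by (simp add: sec_scale_def fun_eq_iff)
  ultimately show ?thesis by simp
qed

lemma h_sec: "\<beta> \<in> sections A \<Longrightarrow> h \<beta> \<in> sections A"
  by (simp add: h_eq sections_diff[OF bundle_A] sub_sectionsD v_sub)

text \<open>The value \<open>v \<beta> []\<close> lies in the ideals, where \<open>v\<close> is the
  identity; so \<open>v\<close> is idempotent and kills
  \<open>\<beta> - v \<beta> []\<close>.\<close>

lemma v_h: "\<beta> \<in> sections A \<Longrightarrow> v (h \<beta>) [] = 0"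
  by (simp add: h_eq v_diff sub_sectionsD v_sub v_id)

lemma h_h: "\<beta> \<in> sections A \<Longrightarrow> h (h \<beta>) = h \<beta>"
  using v_h by (simp add: h_eq)

lemma h_sub: "\<xi> \<in> sub_sections A K \<Longrightarrow> h \<xi> = 0"
  by (simp add: h_eq v_id)

lemma C_zero: "\<alpha> \<in> sections A \<Longrightarrow> X \<in> vfields A \<Longrightarrow> C 0 [X] = 0"
  using C_diff[of \<alpha> \<alpha> X] by simp

section \<open>The curvature and its map kappa\<close>

lemma kappa_conn: "kappa (C, v) (C, v) \<beta> [X] = C \<beta> [X] - C (v \<beta> []) [X]"
  by (simp add: kappa_apply ext_cov_deriv_0 nab_eq)

lemma kappa_conn_sub: "\<xi> \<in> sub_sections A K \<Longrightarrow> kappa (C, v) (C, v) \<xi> [X] = 0"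
  by (simp add: kappa_conn v_id)

text \<open>The forms \<open>C \<alpha>\<close> take values in the ideals, where kappa of the
  connection vanishes, so the \<open>dot_wedge\<close> correction drops out.\<close>

lemma curvature_0:
  assumes "\<alpha> \<in> sections A" "X \<in> vfields A" "Y \<in> vfields A"
  shows "fst (im_curvature (C, v)) \<alpha> [X, Y] = ext_cov_deriv nab (C \<alpha>) [X, Y]"
  using assms by (simp add: im_curvature_def hor_ext_cov_deriv_def dot_wedge_1 kappa_conn_sub C_sub)

text \<open>On \<open>h \<beta>\<close> the subtracted term of \<open>kappa_conn\<close> is
  \<open>C\<close> at \<open>v (h \<beta>) [] = 0\<close>.\<close>

lemma curvature_1:
  assumes "\<beta> \<in> sections A" "X \<in> vfields A"
  shows "snd (im_curvature (C, v)) \<beta> [X] = C (h \<beta>) [X]"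
  using assms by (simp add: im_curvature_def hor_ext_cov_deriv_def kappa_conn v_h C_zero)

lemma kappa_curvature:
  assumes "\<beta> \<in> sections A" "X \<in> vfields A" "Y \<in> vfields A"
  shows "kappa (C, v) (im_curvature (C, v)) \<beta> [X, Y] =
    ext_cov_deriv nab (C \<beta>) [X, Y] - ext_cov_deriv nab (C (h \<beta>)) [X, Y]"
proof -
  \<comment> \<open>The Koszul formula evaluates the one-form only at \<open>X\<close>,
    \<open>Y\<close> and their bracket, all of them vector fields, where \<open>curvature_1\<close>
    applies.\<close>
  have "ext_cov_deriv nab (snd (im_curvature (C, v)) \<beta>) [X, Y] = ext_cov_deriv nab (C (h \<beta>)) [X, Y]"
    unfolding ext_cov_deriv_1 using assms by (simp only: curvature_1 vf_bracket_vfields[OF manifold])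
  then show ?thesis
    by (simp only: kappa_apply curvature_0[OF assms])
qed

text \<open>Since \<open>h\<close> is idempotent, the two terms of \<open>kappa_curvature\<close>
  coincide.\<close>

lemma kappa_curvature_h:
  assumes "\<beta> \<in> sections A" "X \<in> vfields A" "Y \<in> vfields A"
  shows "kappa (C, v) (im_curvature (C, v)) (h \<beta>) [X, Y] = 0"
  using kappa_curvature[OF h_sec[OF assms(1)] assms(2,3)] by (simp only: h_h[OF assms(1)] diff_self)

text \<open>On the ideals \<open>h\<close> vanishes and \<open>C \<xi>\<close> is the covariant
  derivative of \<open>\<xi>\<close>, so kappa of the curvature is the curvature of the induced
  connection.\<close>

lemma kappa_curvature_sub:
  assumes "\<xi> \<in> sub_sections A K" "X \<in> vfields A" "Y \<in> vfields A"
  shows "kappa (C, v) (im_curvature (C, v)) \<xi> [X, Y] =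
    ext_cov_deriv nab (ext_cov_deriv nab (\<lambda>_. \<xi>)) [X, Y]"
proof -
  have \<xi>: "\<xi> \<in> sections A" using assms(1) by (rule sub_sectionsD)
  have "ext_cov_deriv nab (C 0) [X, Y] = 0"
    using assms \<xi> vf_bracket_vfields[OF manifold]
    by (simp add: ext_cov_deriv_1 nab_eq C_zero)
  then show ?thesis
    using assms \<xi> by (simp add: kappa_curvature h_sub ext_cov_deriv_1 ext_cov_deriv_0 nab_eq)
qed

section \<open>The two components of the Bianchi identity\<close>

lemma bianchi_0:
  assumes \<alpha>: "\<alpha> \<in> sections A" and X: "X \<in> vfields A" and Y: "Y \<in> vfields A" and Z: "Z \<in> vfields A"
  shows "fst (hor_ext_cov_deriv (C, v) (im_curvature (C, v))) \<alpha> [X, Y, Z] = 0"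
proof -
  have "ext_cov_deriv nab (fst (im_curvature (C, v)) \<alpha>) [X, Y, Z] =
      ext_cov_deriv nab (ext_cov_deriv nab (C \<alpha>)) [X, Y, Z]"
    using assms vf_bracket_vfields[OF manifold] by (simp add: ext_cov_deriv_2 curvature_0)
  \<comment> \<open>All sections of \<open>A\<close> can serve as \<open>L\<close>:
    \<open>nab X\<close> is \<open>C\<close> evaluated at \<open>X\<close>, which is additive on
    every section and returns sections.\<close>
  also have "\<dots> = dot_wedge (\<lambda>\<xi>. ext_cov_deriv nab (ext_cov_deriv nab (\<lambda>_. \<xi>))) (C \<alpha>) [X, Y, Z]"
    by (rule ext_cov_deriv_square[OF manifold, where L = "sections A" and K = K])
       (use assms in \<open>simp_all add: nab_eq C_diff C_sec C_forms[unfolded One_nat_def] sections_diff[OF bundle_A]\<close>)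
  \<comment> \<open>The values of \<open>C \<alpha>\<close> lie in the ideals, so the curvature of
    \<open>nab\<close> may be replaced by kappa of the IM curvature. The result is exactly the term
    that \<open>hor_ext_cov_deriv\<close> subtracts.\<close>
  also have "\<dots> = dot_wedge (kappa (C, v) (im_curvature (C, v))) (C \<alpha>) [X, Y, Z]"
    using assms by (simp add: dot_wedge_2 kappa_curvature_sub C_sub)
  finally show ?thesis
    by (simp add: hor_ext_cov_deriv_def)
qed

lemma bianchi_1:
  assumes "\<beta> \<in> sections A" "X \<in> vfields A" "Y \<in> vfields A"
  shows "snd (hor_ext_cov_deriv (C, v) (im_curvature (C, v))) \<beta> [X, Y] = 0"
  by (simp only: hor_ext_cov_deriv_def snd_conv kappa_curvature_h[OF assms])

end

theorem theorem5p12: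
  fixes A :: "('m::{t2_space,second_countable_topology}, 'v::real_vector) algebroid"
    and K :: "'m \<Rightarrow> 'v set"
    and C v :: "('m \<Rightarrow> 'v) \<Rightarrow> ('m, 'v) form"
  assumes "lie_algebroid A"
    and "bundle_of_ideals A K"
    and "(C, v) \<in> im_connections A K"
  shows "weil_eq A 3 (hor_ext_cov_deriv (C, v) (im_curvature (C, v))) 0"
proof -
  interpret im_conn A K C v
  proof
    show "vector_bundle A"
      using assms(1) unfolding lie_algebroid_def by blast
    show "(C, v) \<in> weil A K 1"
      using assms(3) unfolding im_connections_def im_forms_def by blast
    show "v \<xi> [] = \<xi>" if "\<xi> \<in> sub_sections A K" for \<xi>
      using assms(3) that unfolding im_connections_def by blast
  qed
  let ?D = "hor_ext_cov_deriv (C, v) (im_curvature (C, v))"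
  have "fst ?D \<alpha> Xs = 0" if "\<alpha> \<in> sections A" "Xs \<in> tuples A 3" for \<alpha> Xs
  proof -
    obtain X Y Z where "Xs = [X, Y, Z]" "X \<in> vfields A" "Y \<in> vfields A" "Z \<in> vfields A"
      using \<open>Xs \<in> tuples A 3\<close> by (auto simp: tuples_def numeral_3_eq_3 length_Suc_conv)
    then show ?thesis using bianchi_0 \<open>\<alpha> \<in> sections A\<close> by blast
  qed
  \<comment> \<open>The second component of a cochain of degree 3 has forms of degree 2 as values,
    so it is tested on pairs.\<close>
  moreover have "snd ?D \<alpha> Xs = 0" if "\<alpha> \<in> sections A" "Xs \<in> tuples A 2" for \<alpha> Xs
  proof -
    obtain X Y where "Xs = [X, Y]" "X \<in> vfields A" "Y \<in> vfields A"
      using \<open>Xs \<in> tuples A 2\<close> by (auto simp: tuples_def numeral_2_eq_2 length_Suc_conv)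
    then show ?thesis using bianchi_1 \<open>\<alpha> \<in> sections A\<close> by blast
  qed
  ultimately show ?thesis
    by (simp add: weil_eq_def zero_fun_def eval_nat_numeral)
qed

end
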